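(* Consider instances in which each request $i\in[n]$ satisfies $s_i\in[1,M]$, $o_i\in[1,M]$ and $s_i+o_i\le M$. Then the algorithm $\mathrm{MC\text{-}SF}_2$, which processes requests with the smallest $s_i+o_i$ first, has unbounded approximation ratio: $$\mathrm{AR}(\mathrm{MC\text{-}SF}_2)=\sup_{\mathcal I}\frac{\mathrm{TEL}(\mathrm{MC\text{-}SF}_2;\mathcal I)}{\mathrm{TEL}(\mathrm{Optimal};\mathcal I)}\longrightarrow\infty\qquad\text{as } M\to\infty,$$ where, for each $M$, the supremum is over all such instances $\mathcal I$ with memory capacity $M$, and $\mathrm{Optimal}$ is a feasible schedule of minimum total end-to-end latency.
   Context: Model. A single worker has memory capacity $M$ (a positive integer). An instance $\mathcal I$ is a finite set of $n$ requests, all available at time $0$; request $i$ has a prefill size $s_i$ and an output length $o_i$, both positive integers. Time is discrete. A schedule $\Lambda$ assigns to each request an integer start time $p_i\ge 0$. Request $i$ then runs without interruption, generating its $j$-th output token ($j=1,\dots,o_i$) at time $p_i+j$ and using $s_i+j$ units of memory at that time, and it completes, releasing its memory, at time $c_i(\Lambda)=p_i+o_i$. The schedule is feasible if at every time $t\ge 1$, $\sum_{i:\,1\le t-p_i\le o_i}(s_i+t-p_i)\le M$. The total end-to-end latency is $\mathrm{TEL}(\Lambda;\mathcal I)=\sum_i c_i(\Lambda)$. Algorithm $\mathrm{MC\text{-}SF}_2$. At each time $t=0,1,2,\dots$, let $\mathcal R^{(t)}$ be the set of requests not yet started and $\mathcal V^{(t)}$ the set of requests in progress (started before $t$ and not completed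 by time $t$), with start times $p_i$. Requests of $\mathcal R^{(t)}$ are considered in nondecreasing order of $s_i+o_i$ (ties broken arbitrarily) and added one by one to a set $U$, all of whose members start at time $t$, as long as the set $U$ including the new request satisfies $$\sum_{i\in\mathcal V^{(t)}}(s_i+t'-p_i)\,\mathbf 1_{\{o_i\ge t'-p_i\}}+\sum_{i\in U}(s_i+t'-t)\,\mathbf 1_{\{o_i\ge t'-t\}}\le M\qquad\text{for all } t'\in\{t,\dots,t_{\max}(U)\},$$ where $t_{\max}(U)=\max_{i\in U}\{t+o_i\}$; the process stops for time $t$ at the first request whose addition violates this condition. *)

theory Defs
  imports Complex_Main "HOL-Library.Extended_Real"
begin

text \<open>A request is the pair of its prefill size and its output length; the requests of an
  instance \<open>I\<close> are the indices \<open>i < length I\<close>. A schedule gives the start time of every request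
  (its values outside \<open>{..<length I}\<close> are irrelevant).\<close>

type_synonym request = "nat \<times> nat"
type_synonym request_instance = "request list"
type_synonym schedule = "nat \<Rightarrow> nat"

definition prefill :: "request_instance \<Rightarrow> nat \<Rightarrow> nat" where
  "prefill I i = fst (I ! i)"

definition outlen :: "request_instance \<Rightarrow> nat \<Rightarrow> nat" where
  "outlen I i = snd (I ! i)"

text \<open>The empty instance is excluded, since the ratio of latencies is then undefined.\<close>

definition instances :: "nat \<Rightarrow> request_instance set" where
  "instances M = {I. I \<noteq> [] \<and> (\<forall>i<length I. prefill I i \<in> {1..M} \<and> outlen I i \<in> {1..M} \<and>
     prefill I i + outlen I i \<le> M)}"

definition completion :: "request_instance \<Rightarrow> schedule \<Rightarrow> nat \<Rightarrow> nat" where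
  "completion I p i = p i + outlen I i"

definition TEL :: "request_instance \<Rightarrow> schedule \<Rightarrow> nat" where
  "TEL I p = (\<Sum>i<length I. completion I p i)"

definition feasible :: "nat \<Rightarrow> request_instance \<Rightarrow> schedule \<Rightarrow> bool" where
  "feasible M I p \<longleftrightarrow> (\<forall>t\<ge>1.
     (\<Sum>i | i < length I \<and> 1 \<le> t - p i \<and> t - p i \<le> outlen I i. prefill I i + (t - p i)) \<le> M)"

definition Optimal :: "nat \<Rightarrow> request_instance \<Rightarrow> schedule" where
  "Optimal M I = (ARG_MIN (TEL I) p. feasible M I p)"

definition waiting :: "request_instance \<Rightarrow> schedule \<Rightarrow> nat \<Rightarrow> nat set" where
  "waiting I p t = {i. i < length I \<and> t \<le> p i}"

definition in_progress :: "request_instance \<Rightarrow> schedule \<Rightarrow> nat \<Rightarrow> nat set" where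
  "in_progress I p t = {i. i < length I \<and> p i < t \<and> t < completion I p i}"

text \<open>Truncated subtraction is harmless here: \<open>p i < t \<le> t'\<close> for the requests in progress.
  The test is only ever applied to nonempty \<open>U\<close>.\<close>

definition fits :: "nat \<Rightarrow> request_instance \<Rightarrow> schedule \<Rightarrow> nat \<Rightarrow> nat set \<Rightarrow> bool" where
  "fits M I p t U \<longleftrightarrow> (\<forall>t' \<in> {t..Max ((\<lambda>i. t + outlen I i) ` U)}.
     (\<Sum>i\<in>in_progress I p t. (prefill I i + (t' - p i)) * of_bool (t' - p i \<le> outlen I i)) +
     (\<Sum>i\<in>U. (prefill I i + (t' - t)) * of_bool (t' - t \<le> outlen I i)) \<le> M)"

fun admit :: "(nat set \<Rightarrow> bool) \<Rightarrow> nat set \<Rightarrow> nat list \<Rightarrow> nat set" where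
  "admit ok U [] = U"
| "admit ok U (i # is) = (if ok (insert i U) then admit ok (insert i U) is else U)"

text \<open>\<open>p\<close> is an outcome of the algorithm on \<open>I\<close>. The list \<open>xs\<close> is the order in which the waiting
  requests are considered at time \<open>t\<close>; ties may be resolved in any way, at each \<open>t\<close> anew. Only
  start times before \<open>t\<close> influence the right-hand side of the last equation.\<close>

definition MC_SF2_run :: "nat \<Rightarrow> request_instance \<Rightarrow> schedule \<Rightarrow> bool" where
  "MC_SF2_run M I p \<longleftrightarrow> (\<forall>t. \<exists>xs. distinct xs \<and> set xs = waiting I p t \<and>
     sorted (map (\<lambda>i. prefill I i + outlen I i) xs) \<and>
     {i. i < length I \<and> p i = t} = admit (fits M I p t) {} xs)"

text \<open>\<open>A\<close> is the algorithm together with some way of breaking ties.\<close>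

definition is_MC_SF2 :: "(nat \<Rightarrow> request_instance \<Rightarrow> schedule) \<Rightarrow> bool" where
  "is_MC_SF2 A \<longleftrightarrow> (\<forall>M. \<forall>I\<in>instances M. MC_SF2_run M I (A M I))"

definition approx_ratio :: "(nat \<Rightarrow> request_instance \<Rightarrow> schedule) \<Rightarrow> nat \<Rightarrow> ereal" where
  "approx_ratio A M =
     (SUP I\<in>instances M. ereal (real (TEL I (A M I)) / real (TEL I (Optimal M I))))"

text \<open>The minimum in \<open>Optimal\<close> is attained, and the predicate \<open>is_MC_SF2\<close> is satisfiable.\<close>

lemma feasible_exists:
  assumes "I \<in> instances M"
  shows "\<exists>p. feasible M I p"
proof
  define p where "p i = (\<Sum>j<i. outlen I j)" for i
  have step: "p i + outlen I i \<le> p j" if "i < j" for i j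
  proof -
    have "(\<Sum>k<Suc i. outlen I k) \<le> (\<Sum>k<j. outlen I k)"
      by (rule sum_mono2) (use that in auto)
    then show ?thesis by (simp add: p_def)
  qed
  show "feasible M I p"
    unfolding feasible_def
  proof (intro allI impI)
    fix t :: nat
    let ?R = "{i. i < length I \<and> 1 \<le> t - p i \<and> t - p i \<le> outlen I i}"
    show "(\<Sum>i\<in>?R. prefill I i + (t - p i)) \<le> M"
    proof (cases "?R = {}")
      case True
      then show ?thesis by (metis (no_types, lifting) sum.empty zero_le)
    next
      case False
      then obtain i where i: "i \<in> ?R" by blast
      have "j = i" if "j \<in> ?R" for j
        using step[of i j] step[of j i] that i by (cases i j rule: linorder_cases) auto
      with i have "?R = {i}" by blast
      then have "(\<Sum>i\<in>?R. prefill I i + (t - p i)) = prefill I i + (t - p i)" by simp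
      also have "\<dots> \<le> prefill I i + outlen I i" using i by simp
      also have "\<dots> \<le> M" using i assms by (simp add: instances_def)
      finally show ?thesis .
    qed
  qed
qed

lemma Optimal_correct:
  assumes "I \<in> instances M"
  shows "feasible M I (Optimal M I)" and "feasible M I q \<Longrightarrow> TEL I (Optimal M I) \<le> TEL I q"
  using feasible_exists[OF assms] arg_min_nat_lemma[of "feasible M I" _ "TEL I"]
  by (auto simp: Optimal_def)

lemma admit_mono: "U \<subseteq> admit ok U xs"
  by (induction ok U xs rule: admit.induct) auto

lemma admit_subset: "admit ok U xs \<subseteq> U \<union> set xs"
  by (induction ok U xs rule: admit.induct) auto

lemma MC_SF2_run_exists:
  assumes "I \<in> instances M"
  shows "\<exists>p. MC_SF2_run M I p"
proof -
  define key where "key i = prefill I i + outlen I i" for i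
  define ord where "ord p t = sort_key key (sorted_list_of_set (waiting I p t))" for p t
  define adm where "adm p t = admit (fits M I p t) {} (ord p t)" for p t
  define g where "g = rec_nat (\<lambda>i. 0)
    (\<lambda>t p i. if p i < t then p i else if i \<in> adm p t then t else Suc t)"
  have g0: "g 0 i = 0" for i by (simp add: g_def)
  have gS: "g (Suc t) i = (if g t i < t then g t i else if i \<in> adm (g t) t then t else Suc t)"
    for t i by (simp add: g_def)
  have fin: "finite (waiting I p t)" for p t by (simp add: waiting_def)
  have ord: "distinct (ord p t)" "set (ord p t) = waiting I p t" "sorted (map key (ord p t))" for p t
    using fin by (simp_all add: ord_def)
  have le: "g t i \<le> t" for t i
    by (induction t) (auto simp: g0 gS)
  have stable: "g (t + d) i = g t i" if "g t i < t" for t d i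
    by (induction d) (use that in \<open>auto simp: gS\<close>)
  have stable': "g u i = g t i" if "g t i < t" "t \<le> u" for t u i
    using stable[OF that(1), of "u - t"] that(2) by simp
  have started: "\<exists>T. g T i < T" if i: "i < length I" for i
  proof (rule ccontr)
    assume "\<not> ?thesis"
    then have never: "g T i = T" for T using le[of T i] by (metis le_neq_implies_less)
    define T where "T j = (SOME T. g T j < T)" for j
    define B where "B = (\<Sum>j<length I. T j + outlen I j)"
    have finished: "g B j + outlen I j \<le> B \<and> g B j < B" if "j < length I" "g u j < u" for j u
    proof -
      have T: "g (T j) j < T j" unfolding T_def using that(2) by (rule someI)
      have "T j + outlen I j \<le> B" unfolding B_def
        by (rule member_le_sum[where f = "\<lambda>j. T j + outlen I j"]) (use that in auto)
      with T stable'[OF T, of B] show ?thesis by simp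
    qed
    have "B \<le> g B j \<or> g B j + outlen I j \<le> B" if "j < length I" for j
      using finished[OF that, of B] by (meson not_le_imp_less)
    then have idle: "in_progress I (g B) B = {}"
      by (fastforce simp: in_progress_def completion_def)
    have "i \<in> set (ord (g B) B)" using i never[of B] ord(2)[of "g B" B] by (simp add: waiting_def)
    then obtain x xs where xs: "ord (g B) B = x # xs" by (cases "ord (g B) B") auto
    with ord(2)[of "g B" B] have "x \<in> waiting I (g B) B" by auto
    then have x: "x < length I" "B \<le> g B x" by (auto simp: waiting_def)
    have "prefill I x + outlen I x \<le> M" using assms x by (simp add: instances_def)
    then have "fits M I (g B) B {x}" by (auto simp: fits_def idle of_bool_def)
    then have "x \<in> adm (g B) B" using admit_mono[of "{x}"] by (auto simp: adm_def xs)
    then have "g (Suc B) x < Suc B" using x by (simp add: gS)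
    from finished[OF x(1) this] x show False by simp
  qed
  define p where "p i = (if \<exists>T. g T i < T then g (SOME T. g T i < T) i else 0)" for i
  have p: "g t i = min (p i) t" if "i < length I" for t i
  proof -
    define T where "T = (SOME T. g T i < T)"
    have T: "g T i < T" unfolding T_def using started[OF that] by (rule someI_ex)
    have p_eq: "p i = g T i" using started[OF that] by (simp add: p_def T_def)
    show ?thesis
    proof (cases "g t i < t")
      case True
      then have "g t i = g T i" using stable'[of t i T] stable'[OF T, of t] by (cases "t \<le> T") auto
      then show ?thesis using True p_eq by simp
    next
      case False
      then have "g t i = t" using le[of t i] by simp
      moreover have "t \<le> p i"
      proof (rule ccontr)
        assume "\<not> t \<le> p i"
        then have lt: "g T i < t" using p_eq by simp
        show False
        proof (cases "T \<le> t")
          case True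
          then show False using stable'[OF T True] False lt by simp
        next
          case False': False
          have "t \<le> g u i" if "t \<le> u" for u
            using that
          proof (induction u rule: dec_induct)
            case base
            then show ?case using False by simp
          qed (auto simp: gS)
          then show False using False' lt by (meson leD nat_le_linear)
        qed
      qed
      ultimately show ?thesis by simp
    qed
  qed
  have w: "waiting I p t = waiting I (g t) t" for t by (auto simp: waiting_def p)
  have ip: "in_progress I p t = in_progress I (g t) t" for t
    by (auto simp: in_progress_def completion_def p)
  have f: "fits M I p t = fits M I (g t) t" for t
  proof -
    have "p i = g t i" if "i \<in> in_progress I (g t) t" for i
      using that by (auto simp: in_progress_def p)
    then show ?thesis by (simp add: fun_eq_iff fits_def ip cong: sum.cong)
  qed
  have "{i. i < length I \<and> p i = t} = admit (fits M I p t) {} (ord p t)" for t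
  proof -
    have a: "adm p t = adm (g t) t" by (simp add: adm_def f ord_def w)
    have sub: "adm p t \<subseteq> waiting I p t"
      unfolding adm_def using admit_subset[of _ "{}" "ord p t"] ord(2)[of p t] by auto
    have "p i = t \<longleftrightarrow> i \<in> adm p t" if "i < length I" for i
    proof (cases "p i < t")
      case True
      then show ?thesis using sub by (auto simp: waiting_def)
    next
      case False
      then have "g (Suc t) i = (if i \<in> adm p t then t else Suc t)"
        using that by (simp add: gS a p)
      then show ?thesis using p[OF that, of "Suc t"] False by (auto split: if_splits)
    qed
    then have "{i. i < length I \<and> p i = t} = adm p t"
      using sub by (auto simp: waiting_def)
    then show ?thesis by (simp add: adm_def)
  qed
  moreover have "sorted (map (\<lambda>i. prefill I i + outlen I i) (ord p t))" for t
    using ord(3)[of p t] by (simp add: key_def[abs_def])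
  ultimately have "MC_SF2_run M I p"
    unfolding MC_SF2_run_def using ord(1,2) by blast
  then show ?thesis by (intro exI[of _ p])
qed

lemma is_MC_SF2_exists: "\<exists>A. is_MC_SF2 A"
proof
  have "MC_SF2_run M I (SOME p. MC_SF2_run M I p)" if "I \<in> instances M" for M I
    using MC_SF2_run_exists[OF that] by (rule someI_ex)
  then show "is_MC_SF2 (\<lambda>M I. SOME p. MC_SF2_run M I p)"
    by (simp add: is_MC_SF2_def)
qed

end

theory Submission imports Defs begin

text \<open>The algorithm ranks requests by their peak memory \<open>s + o\<close> and ignores for how long they hold
  it. Take one request \<open>(1, M - 2)\<close>, with peak \<open>M - 1\<close>, and \<open>x\<close> requests \<open>(M - 1, 1)\<close>, with
  peak \<open>M\<close>. The long request has the smaller peak, so it starts first, and from then on it leaves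
  less than the \<open>M - 1\<close> units that a short request needs at once. Hence all short requests
  wait until time \<open>M - 2\<close> (lemma \<open>short_delayed\<close>), and the latency is at least \<open>x * (M - 2)\<close>.

  Running the \<open>x\<close> short requests first, one per time step, delays the long request only by
  \<open>x\<close>; the latency is then at most \<open>x\<^sup>2 + x + M\<close> (lemmas \<open>short_first_feasible\<close> and
  \<open>TEL_short_first\<close>). For \<open>x\<close> of the order of the square root of \<open>M\<close>, the optimum is linear
  in \<open>M\<close> while the algorithm pays \<open>x\<close> times as much, so the ratio grows at least like \<open>x\<close>.\<close>

lemma admit_blocked:
  assumes "\<And>i. i \<in> set xs \<Longrightarrow> \<not> ok (insert i U)"
  shows "admit ok U xs = U"
  using assms by (cases xs) auto

lemma fits_memory_le:
  assumes "fits M I p t U" and "finite U" and "j \<in> U" and "t \<le> t'" and "t' \<le> t + outlen I j"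
  shows "(\<Sum>i\<in>in_progress I p t. (prefill I i + (t' - p i)) * of_bool (t' - p i \<le> outlen I i)) +
    (\<Sum>i\<in>U. (prefill I i + (t' - t)) * of_bool (t' - t \<le> outlen I i)) \<le> M"
proof -
  have "t + outlen I j \<le> Max ((\<lambda>i. t + outlen I i) ` U)"
    using assms(2,3) by (intro Max_ge) auto
  with assms(1,4,5) show ?thesis by (auto simp: fits_def)
qed

definition bad_instance :: "nat \<Rightarrow> nat \<Rightarrow> request_instance" where
  "bad_instance M x = (1, M - 2) # replicate x (M - 1, 1)"

definition short_first :: "nat \<Rightarrow> schedule" where
  "short_first x i = (if i = 0 then x else i - 1)"

lemma bad_instance_simps [simp]:
  "length (bad_instance M x) = Suc x"
  "prefill (bad_instance M x) 0 = 1"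
  "outlen (bad_instance M x) 0 = M - 2"
  "0 < i \<Longrightarrow> i \<le> x \<Longrightarrow> prefill (bad_instance M x) i = M - 1"
  "0 < i \<Longrightarrow> i \<le> x \<Longrightarrow> outlen (bad_instance M x) i = 1"
  by (auto simp: bad_instance_def prefill_def outlen_def nth_Cons')

lemma bad_instance_in_instances:
  assumes "3 \<le> M"
  shows "bad_instance M x \<in> instances M"
proof -
  have "prefill (bad_instance M x) i \<in> {1..M} \<and> outlen (bad_instance M x) i \<in> {1..M} \<and>
     prefill (bad_instance M x) i + outlen (bad_instance M x) i \<le> M" if "i \<le> x" for i
    using assms that by (cases "i = 0") auto
  moreover have "bad_instance M x \<noteq> []" by (simp add: bad_instance_def)
  ultimately show ?thesis by (simp add: instances_def less_Suc_eq_le)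
qed

text \<open>A request uses memory only at the times after its start, up to its completion. The sets
  \<open>{1}, \<dots>, {x}, {x<..x + M - 2}\<close> of these times are disjoint, so no two requests ever compete.\<close>
lemma short_first_feasible:
  assumes "3 \<le> M"
  shows "feasible M (bad_instance M x) (short_first x)"
  unfolding feasible_def
proof (intro allI impI)
  fix t :: nat
  assume "1 \<le> t"
  let ?I = "bad_instance M x" and ?p = "short_first x"
  let ?R = "{i. i < length ?I \<and> 1 \<le> t - ?p i \<and> t - ?p i \<le> outlen ?I i}"
  define j where "j = (if t \<le> x then t else 0)"
  have "i = j" if "i \<in> ?R" for i
    using that by (cases "i = 0") (auto simp: j_def short_first_def)
  then have R: "?R \<subseteq> {j}" by blast
  show "(\<Sum>i\<in>?R. prefill ?I i + (t - ?p i)) \<le> M"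
  proof (cases "?R = {}")
    case True
    then show ?thesis by (metis (no_types, lifting) sum.empty zero_le)
  next
    case False
    with R have "?R = {j}" and j: "j \<in> ?R" by blast+
    then have "(\<Sum>i\<in>?R. prefill ?I i + (t - ?p i)) = prefill ?I j + (t - ?p j)" by simp
    also have "\<dots> \<le> prefill ?I j + outlen ?I j" using j by simp
    also have "\<dots> \<le> M"
      using bad_instance_in_instances[OF assms, of x] j by (simp add: instances_def)
    finally show ?thesis .
  qed
qed

lemma TEL_short_first: "TEL (bad_instance M x) (short_first x) \<le> x + M + x * x"
proof -
  have "(\<Sum>i<x. completion (bad_instance M x) (short_first x) (Suc i)) \<le> (\<Sum>i<x. x)"
    by (rule sum_mono) (auto simp: completion_def short_first_def)
  then show ?thesis
    by (simp add: TEL_def sum.lessThan_Suc_shift completion_def short_first_def del: sum.lessThan_Suc)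
qed

text \<open>A short request cannot start together with the long one: one step later the two would use
  \<open>M + 2\<close> units. Nor can it start while the long one is running, since its prefill \<open>M - 1\<close>
  would be added to at least \<open>2\<close> occupied units.\<close>
lemma short_delayed:
  assumes M: "3 \<le> M" and run: "MC_SF2_run M (bad_instance M x) p" and i: "0 < i" "i \<le> x"
  shows "M - 2 \<le> p i"
proof -
  let ?I = "bad_instance M x"
  have run_at: "\<exists>xs. distinct xs \<and> set xs = waiting ?I p t \<and>
      sorted (map (\<lambda>i. prefill ?I i + outlen ?I i) xs) \<and>
      {i. i < length ?I \<and> p i = t} = admit (fits M ?I p t) {} xs" for t
    using run unfolding MC_SF2_run_def by (rule spec)
  obtain xs where xs: "distinct xs" "set xs = waiting ?I p 0"
      "sorted (map (\<lambda>i. prefill ?I i + outlen ?I i) xs)"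
      and start0: "{i. i < length ?I \<and> p i = 0} = admit (fits M ?I p 0) {} xs"
    using run_at[of 0] by (elim exE conjE)
  have set_xs: "set xs = {..x}" unfolding xs(2) by (auto simp: waiting_def)
  then have "xs \<noteq> []" by (metis atMost_iff empty_iff le_refl list.set(1))
  then obtain y ys where ys: "xs = y # ys" by (meson neq_Nil_conv)
  have "y = 0"
  proof (rule ccontr)
    assume "y \<noteq> 0"
    moreover have "0 \<in> set xs" unfolding set_xs by simp
    ultimately have "0 \<in> set ys" using ys by simp
    moreover have "y \<in> set xs" using ys by simp
    then have "y \<le> x" unfolding set_xs by simp
    ultimately have "prefill ?I y + outlen ?I y \<le> prefill ?I 0 + outlen ?I 0"
      using xs(3) unfolding ys list.map sorted_simps set_map by blast
    with \<open>y \<noteq> 0\<close> \<open>y \<le> x\<close> M show False by simp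
  qed
  have idle: "in_progress ?I p 0 = {}" by (simp add: in_progress_def)
  have "fits M ?I p 0 {0}"
    using M by (auto simp: fits_def idle of_bool_def)
  moreover have "\<not> fits M ?I p 0 {j, 0}" if "j \<in> set ys" for j
  proof
    assume f: "fits M ?I p 0 {j, 0}"
    have "j \<in> set xs" using that ys by simp
    moreover have "j \<noteq> 0" using that xs(1) ys \<open>y = 0\<close> by (metis distinct.simps(2))
    ultimately have j: "0 < j" "j \<le> x" unfolding set_xs by simp_all
    show False using fits_memory_le[OF f, of j 1] j M by (simp add: idle)
  qed
  ultimately have "admit (fits M ?I p 0) {} xs = {0}"
    using ys \<open>y = 0\<close> by (simp add: admit_blocked)
  with start0 have at0: "{i. i < length ?I \<and> p i = 0} = {0}" by simp
  then have p0: "p 0 = 0" by blast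
  have "p i \<noteq> t" if t: "t < M - 2" for t
  proof (cases "t = 0")
    case True
    have "i \<notin> {i. i < length ?I \<and> p i = 0}" unfolding at0 using i by simp
    then show ?thesis using True i by simp
  next
    case False
    obtain zs where zs: "set zs = waiting ?I p t"
      and start: "{i. i < length ?I \<and> p i = t} = admit (fits M ?I p t) {} zs"
      using run_at[of t] by (elim exE conjE)
    have "\<not> fits M ?I p t {j}" if "j \<in> set zs" for j
    proof
      assume f: "fits M ?I p t {j}"
      have j: "0 < j" "j \<le> x" using that zs False p0 by (cases "j = 0"; simp add: waiting_def)+
      have "0 \<in> in_progress ?I p t" using p0 t False by (simp add: in_progress_def completion_def)
      then have "(prefill ?I 0 + (t - p 0)) * of_bool (t - p 0 \<le> outlen ?I 0)
          \<le> (\<Sum>i\<in>in_progress ?I p t. (prefill ?I i + (t - p i)) * of_bool (t - p i \<le> outlen ?I i))"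
        by (intro member_le_sum) (auto simp: in_progress_def)
      then have "1 + t \<le> (\<Sum>i\<in>in_progress ?I p t. (prefill ?I i + (t - p i)) * of_bool (t - p i \<le> outlen ?I i))"
        using p0 t by simp
      with fits_memory_le[OF f, of j t] j M False show False by simp
    qed
    then have "{i. i < length ?I \<and> p i = t} = {}"
      using start by (simp add: admit_blocked)
    then show ?thesis using i by auto
  qed
  then show ?thesis using not_le_imp_less by blast
qed

text \<open>The condition \<open>x * x \<le> M\<close> keeps the optimum at most \<open>3 * M\<close>; a further factor \<open>3\<close> comes
  from \<open>M \<le> 3 * (M - 2)\<close>.\<close>
lemma approx_ratio_ge:
  assumes A: "is_MC_SF2 A" and M: "3 \<le> M" and x: "x * x \<le> M"
  shows "ereal (real x / 9) \<le> approx_ratio A M"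
proof -
  let ?I = "bad_instance M x"
  have I: "?I \<in> instances M" by (rule bad_instance_in_instances[OF M])
  have "MC_SF2_run M ?I (A M ?I)" using A I by (simp add: is_MC_SF2_def)
  then have late: "M - 2 \<le> A M ?I (Suc i)" if "i < x" for i
    using short_delayed[OF M] that by simp
  have "x * (M - 2) = (\<Sum>i<x. M - 2)" by simp
  also have "\<dots> \<le> (\<Sum>i<x. completion ?I (A M ?I) (Suc i))"
    by (rule sum_mono) (use late in \<open>auto simp: completion_def intro: le_SucI\<close>)
  also have "\<dots> \<le> TEL ?I (A M ?I)"
    by (simp add: TEL_def sum.lessThan_Suc_shift del: sum.lessThan_Suc)
  finally have alg: "x * (M - 2) \<le> TEL ?I (A M ?I)" .
  have "x \<le> x * x" by (rule le_square)
  then have opt: "TEL ?I (Optimal M ?I) \<le> 3 * M"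
    using Optimal_correct(2)[OF I short_first_feasible[OF M]] TEL_short_first[of M x] x by linarith
  \<comment> \<open>With a zero optimum, the quotient would be zero instead of large.\<close>
  have pos: "0 < TEL ?I (Optimal M ?I)"
    using M by (simp add: TEL_def completion_def sum.lessThan_Suc_shift del: sum.lessThan_Suc)
  have "x * TEL ?I (Optimal M ?I) \<le> x * (3 * M)" using opt by (rule mult_le_mono2)
  also have "\<dots> \<le> x * (9 * (M - 2))" using M by (intro mult_le_mono2) simp
  also have "\<dots> \<le> 9 * TEL ?I (A M ?I)" using alg by simp
  finally have "real (x * TEL ?I (Optimal M ?I)) \<le> real (9 * TEL ?I (A M ?I))"
    by (rule of_nat_mono)
  then have "real x / 9 \<le> real (TEL ?I (A M ?I)) / real (TEL ?I (Optimal M ?I))"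
    using pos by (simp add: field_simps)
  then show ?thesis
    unfolding approx_ratio_def by (intro SUP_upper2[OF I]) simp
qed

theorem mainTheorem4:
  fixes A :: "nat \<Rightarrow> request_instance \<Rightarrow> schedule"
  assumes "is_MC_SF2 A"
  shows "(\<lambda>M. approx_ratio A M) \<longlonglongrightarrow> \<infinity>"
  unfolding tendsto_PInfty
proof
  fix r :: real
  obtain x :: nat where x: "9 * r < real x" using reals_Archimedean2 by blast
  have "ereal r < approx_ratio A M" if "max 3 (x * x) \<le> M" for M
  proof -
    have "ereal r < ereal (real x / 9)" using x by simp
    also have "\<dots> \<le> approx_ratio A M" using that by (intro approx_ratio_ge[OF assms]) auto
    finally show ?thesis .
  qed
  then show "eventually (\<lambda>M. ereal r < approx_ratio A M) sequentially"
    unfolding eventually_sequentially by blast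
qed

end
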